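(* Let $d$ be a nonnegative integer and $V$ a finite set. Consider the posimodular function minimization problem restricted to posimodular functions $f:2^V\to\{0,1,\dots,d\}$ given by a value oracle: output a nonempty subset $X^*\subseteq V$ with $f(X^* )=\min\{f(X)\mid X\subseteq V,\ X\neq\emptyset\}$ together with $f(X^* )$. Any algorithm for this problem requires $\Omega(2^{d/15.08})$ oracle calls in the worst case.
   Context: A set function $f:2^V\to\mathbb{R}$ is posimodular if $f(X)+f(Y)\ge f(X\setminus Y)+f(Y\setminus X)$ for all $X,Y\subseteq V$. The function is accessible only through an oracle returning $f(X)$ for a queried $X\subseteq V$. Throughout, $f(\emptyset)=0$ is assumed. *)

theory Defs
  imports Complex_Main
begin

definition posimodular :: "'a set \<Rightarrow> ('a set \<Rightarrow> real) \<Rightarrow> bool" where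
  "posimodular V f \<longleftrightarrow> (\<forall>X Y. X \<subseteq> V \<longrightarrow> Y \<subseteq> V \<longrightarrow> f X + f Y \<ge> f (X - Y) + f (Y - X))"

text \<open>A set function on \<open>V\<close> is a total function on \<open>'a set\<close>; its values outside
  \<open>Pow V\<close> are unconstrained and irrelevant.\<close>

definition instances :: "'a set \<Rightarrow> nat \<Rightarrow> ('a set \<Rightarrow> real) set" where
  "instances V d = {f. posimodular V f \<and> f {} = 0 \<and> f ` Pow V \<subseteq> real ` {0..d}}"

text \<open>A deterministic algorithm with oracle access is an adaptive decision tree: it either
  stops with an output (a set and a claimed value), or queries a set and continues depending
  on the answer. Computation between oracle calls is unrestricted and free. Elements of the
  datatype are well-founded, so every run is finite.\<close>

datatype 'a algorithm =
  Output "'a set" real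
| Query "'a set" "real \<Rightarrow> 'a algorithm"

primrec run :: "'a algorithm \<Rightarrow> ('a set \<Rightarrow> real) \<Rightarrow> 'a set \<times> real" where
  "run (Output X v) = (\<lambda>f. (X, v))"
| "run (Query X k) = (\<lambda>f. run (k (f X)) f)"

primrec queries :: "'a algorithm \<Rightarrow> ('a set \<Rightarrow> real) \<Rightarrow> 'a set list" where
  "queries (Output X v) = (\<lambda>f. [])"
| "queries (Query X k) = (\<lambda>f. X # queries (k (f X)) f)"

definition oracle_calls :: "'a algorithm \<Rightarrow> ('a set \<Rightarrow> real) \<Rightarrow> nat" where
  "oracle_calls A f = length (queries A f)"

text \<open>The algorithm may be tailored to \<open>V\<close> and \<open>d\<close>. Querying all nonempty subsets solves the
  problem with \<open>2 ^ card V - 1\<close> calls, so a lower bound in terms of \<open>d\<close> alone can only hold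
  when \<open>card V\<close> is not small compared to \<open>d\<close>; for a single very large \<open>V\<close> it would
  follow already from the trivial bound linear in \<open>card V\<close> (for \<open>d \<ge> 1\<close>).\<close>

definition solves :: "'a algorithm \<Rightarrow> 'a set \<Rightarrow> nat \<Rightarrow> bool" where
  "solves A V d \<longleftrightarrow> (\<forall>f \<in> instances V d.
     set (queries A f) \<subseteq> Pow V \<and>
     (\<exists>X v. run A f = (X, v) \<and> X \<subseteq> V \<and> X \<noteq> {} \<and>
        f X = Min {f Y |Y. Y \<subseteq> V \<and> Y \<noteq> {}} \<and> v = f X))"

end

theory Submission
  imports Defs
begin

text \<open>Fix \<open>W \<subseteq> V\<close> with \<open>card W = 2 * r\<close> and \<open>r = d div 4\<close>. The base
  function counts the elements in \<open>W\<close>, plus \<open>1\<close> for sets that leave \<open>W\<close>; it is monotone and at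
  least \<open>1\<close> on nonempty sets. For \<open>S \<subseteq> W\<close>, replacing its value by \<open>card (S - X)\<close> on the sets
  \<open>X \<subseteq> S\<close> with more than half of the elements of \<open>S\<close> keeps posimodularity, and lowers the
  minimum to \<open>0\<close>. While the answers are those of the base function, a query \<open>X\<close> only rules out
  sets \<open>S \<supseteq> X\<close> with \<open>2 * card X > card S\<close>. Let \<open>S\<close> range over the \<open>2 ^ r\<close> transversals of a
  perfect matching of \<open>W\<close>: a query rules out at most \<open>2 ^ (r - card X)\<close> of them, so at least
  \<open>2 powr (r / 2)\<close> queries are needed.\<close>

text \<open>Agreement is demanded only on the sets queried along the run on \<open>f\<close>: equal
  answers keep both runs on the same branch of the tree.\<close>

lemma run_cong:
  "(\<And>X. X \<in> set (queries A f) \<Longrightarrow> f X = g X) \<Longrightarrow> run A f = run A g"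
proof (induction A)
  case (Query X k)
  from Query.prems[of X] have "f X = g X" by simp
  moreover have "run (k (f X)) f = run (k (f X)) g"
    using Query.prems by (intro Query.IH) auto
  ultimately show ?case by simp
qed simp

section \<open>Base function and hidden functions\<close>

definition base_fun :: "'a set \<Rightarrow> 'a set \<Rightarrow> real" where
  "base_fun W X = real (card (X \<inter> W)) + of_bool (\<not> X \<subseteq> W)"

text \<open>For finite \<open>S\<close> and \<open>S \<subseteq> W\<close>, the value on
  \<open>X \<subseteq> S\<close> is the minimum of \<open>card X\<close> and
  \<open>card (S - X)\<close>, a symmetric function on the subsets of \<open>S\<close>.\<close>

definition hidden_fun :: "'a set \<Rightarrow> 'a set \<Rightarrow> 'a set \<Rightarrow> real" where
  "hidden_fun W S X =
     (if X \<subseteq> S \<and> card S < 2 * card X then real (card (S - X)) else base_fun W X)"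

lemma base_fun_mono:
  assumes "finite W" "X \<subseteq> Y"
  shows "base_fun W X \<le> base_fun W Y"
proof -
  have "card (X \<inter> W) \<le> card (Y \<inter> W)"
    using assms by (intro card_mono) auto
  then show ?thesis
    using assms by (auto simp: base_fun_def)
qed

lemma base_fun_subset: "X \<subseteq> W \<Longrightarrow> base_fun W X = real (card X)"
  by (simp add: base_fun_def Int_absorb2)

text \<open>Removing elements of \<open>W\<close> does not affect whether a set leaves
  \<open>W\<close>, so only the counting term drops. This exact loss pays for the mixed case of
  \<open>hidden_fun_posimodular\<close>.\<close>

lemma base_fun_Diff:
  assumes "finite W" "X \<subseteq> W"
  shows "base_fun W Y = base_fun W (Y - X) + real (card (X \<inter> Y))"
proof -
  have "Y \<inter> W = ((Y - X) \<inter> W) \<union> (X \<inter> Y)"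
    using assms by auto
  moreover have "card (((Y - X) \<inter> W) \<union> (X \<inter> Y)) = card ((Y - X) \<inter> W) + card (X \<inter> Y)"
    using assms by (intro card_Un_disjoint) (auto intro: finite_subset)
  moreover have "Y - X \<subseteq> W \<longleftrightarrow> Y \<subseteq> W"
    using assms by auto
  ultimately show ?thesis
    by (simp add: base_fun_def)
qed

lemma base_fun_ge_1:
  assumes "finite W" "X \<noteq> {}"
  shows "base_fun W X \<ge> 1"
proof (cases "X \<subseteq> W")
  case True
  then have "card X \<ge> 1"
    using assms by (simp add: Suc_leI card_gt_0_iff finite_subset)
  then show ?thesis using True by (simp add: base_fun_subset)
qed (simp add: base_fun_def)

text \<open>The strict bound on \<open>card W\<close> leaves room for the extra 1 on sets that leave
  \<open>W\<close>.\<close>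

lemma base_fun_range:
  assumes "finite W" "card W < d"
  shows "base_fun W X \<in> real ` {0..d}"
proof -
  have "card (X \<inter> W) \<le> card W"
    using assms by (simp add: card_mono)
  then have "card (X \<inter> W) + of_bool (\<not> X \<subseteq> W) \<in> {0..d}"
    using assms by auto
  moreover have "base_fun W X = real (card (X \<inter> W) + of_bool (\<not> X \<subseteq> W))"
    by (simp add: base_fun_def)
  ultimately show ?thesis by blast
qed

section \<open>Posimodularity and membership in the instance class\<close>

lemma posimodular_mono:
  assumes "\<And>X Y. X \<subseteq> Y \<Longrightarrow> f X \<le> f Y"
  shows "posimodular V f"
  unfolding posimodular_def using assms by (meson Diff_subset add_mono)

lemma base_fun_instances:
  assumes "finite W" "card W < d"
  shows "base_fun W \<in> instances V d"
  unfolding instances_def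
  using posimodular_mono[of "base_fun W" V] base_fun_mono[OF assms(1)] base_fun_range[OF assms]
  by (auto simp: base_fun_subset)

lemma hidden_fun_le_base_fun:
  assumes "finite W" "S \<subseteq> W"
  shows "hidden_fun W S X \<le> base_fun W X"
proof -
  have "card (S - X) \<le> card X" if "X \<subseteq> S" "card S < 2 * card X"
    using that assms by (simp add: card_Diff_subset finite_subset)
  then show ?thesis
    using assms by (auto simp: hidden_fun_def base_fun_subset)
qed

text \<open>Where the value is not lowered, \<open>X\<close> has at most half of the elements of
  \<open>S\<close>, so \<open>card X\<close> is at most the size of its complement in
  \<open>S\<close>.\<close>

lemma hidden_fun_le_card_Diff:
  assumes "S \<subseteq> W" "X \<subseteq> S" "finite S"
  shows "hidden_fun W S X \<le> real (card S) - real (card X)"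
  using assms card_mono[of S X] finite_subset[of X S]
  by (auto simp: hidden_fun_def base_fun_subset card_Diff_subset of_nat_diff)

lemma hidden_fun_posimodular:
  assumes W: "finite W" and S: "S \<subseteq> W"
  shows "posimodular V (hidden_fun W S)"
proof -
  define low where "low X \<longleftrightarrow> X \<subseteq> S \<and> card S < 2 * card X" for X
  have finS: "finite S" using W S finite_subset by blast
  have low: "hidden_fun W S X = real (card S) - real (card X)" if "low X" for X
    using that finS card_mono[of S X] finite_subset[of X S]
    by (auto simp: low_def hidden_fun_def card_Diff_subset of_nat_diff)
  have nlow: "hidden_fun W S X = base_fun W X" if "\<not> low X" for X
    using that by (auto simp: low_def hidden_fun_def)
  have le: "hidden_fun W S X \<le> base_fun W X" for X
    using hidden_fun_le_base_fun[OF W S] .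
  have mixed: "hidden_fun W S (X - Y) + hidden_fun W S (Y - X)
      \<le> hidden_fun W S X + hidden_fun W S Y" if X: "low X" and Y: "\<not> low Y" for X Y
  proof -
    have XS: "X \<subseteq> S" using X by (simp add: low_def)
    \<comment> \<open>Passing from \<open>X\<close> to \<open>X - Y\<close> gains at most
      \<open>card (X \<inter> Y)\<close>, and passing from \<open>Y\<close> to \<open>Y - X\<close>
      loses at least as much.\<close>
    have "card X = card (X - Y) + card (X \<inter> Y)"
      using card_Int_Diff[of X Y] finite_subset[OF XS finS] by simp
    moreover have "hidden_fun W S (X - Y) \<le> real (card S) - real (card (X - Y))"
      using XS finS S by (intro hidden_fun_le_card_Diff) auto
    moreover have "base_fun W Y = base_fun W (Y - X) + real (card (X \<inter> Y))"
      using XS S by (intro base_fun_Diff W) auto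
    ultimately show ?thesis
      using low[OF X] nlow[OF Y] le[of "Y - X"] by simp
  qed
  have "hidden_fun W S (X - Y) + hidden_fun W S (Y - X)
      \<le> hidden_fun W S X + hidden_fun W S Y" for X Y
  proof (cases "low X"; cases "low Y")
    assume X: "low X" and Y: "low Y"
    then have sub: "X \<subseteq> S" "Y \<subseteq> S" by (auto simp: low_def)
    then have fin: "finite X" "finite Y" using finS finite_subset by blast+
    \<comment> \<open>Bounding the values at the differences by their cardinalities reduces the
      claim to \<open>2 * card (X \<union> Y) \<le> 2 * card S\<close>.\<close>
    have "card (X \<union> Y) \<le> card S" using sub finS by (intro card_mono) auto
    moreover have "card X + card Y = card (X \<union> Y) + card (X \<inter> Y)"
      using card_Un_Int fin by blast
    moreover have "card X = card (X - Y) + card (X \<inter> Y)" "card Y = card (Y - X) + card (X \<inter> Y)"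
      using fin card_Int_Diff[of X Y] card_Int_Diff[of Y X] by (simp_all add: Int_commute)
    moreover have "hidden_fun W S (X - Y) \<le> card (X - Y)" "hidden_fun W S (Y - X) \<le> card (Y - X)"
      using sub S le[of "X - Y"] le[of "Y - X"] base_fun_subset[of "X - Y" W]
        base_fun_subset[of "Y - X" W] by (simp_all add: subset_iff)
    ultimately show ?thesis
      using low[OF X] low[OF Y] by linarith
  next
    assume "low X" "\<not> low Y"
    then show ?thesis by (rule mixed)
  next
    assume "\<not> low X" "low Y"
    then show ?thesis using mixed[of Y X] by linarith
  next
    assume X: "\<not> low X" and Y: "\<not> low Y"
    have "base_fun W (X - Y) \<le> base_fun W X" "base_fun W (Y - X) \<le> base_fun W Y"
      by (auto intro: base_fun_mono W)
    then show ?thesis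
      using nlow[OF X] nlow[OF Y] le[of "X - Y"] le[of "Y - X"] by linarith
  qed
  then show ?thesis unfolding posimodular_def by blast
qed

lemma hidden_fun_instances:
  assumes "finite W" "card W < d" "S \<subseteq> W"
  shows "hidden_fun W S \<in> instances V d"
proof -
  have "hidden_fun W S X \<in> real ` {0..d}" for X
  proof -
    have "card (S - X) \<le> card W"
      using assms by (intro card_mono) auto
    then show ?thesis
      using base_fun_range[OF assms(1,2)] assms(2) by (auto simp: hidden_fun_def)
  qed
  moreover have "hidden_fun W S {} = 0"
    by (simp add: hidden_fun_def base_fun_def)
  ultimately show ?thesis
    using hidden_fun_posimodular[OF assms(1,3)] by (auto simp: instances_def)
qed

section \<open>Indistinguishability of base and hidden functions\<close>

lemma solves_query_half:
  assumes A: "solves A V d" and V: "finite V" "W \<subseteq> V" "card W < d"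
    and S: "S \<subseteq> W" "S \<noteq> {}"
  obtains X where "X \<in> set (queries A (base_fun W))" "X \<subseteq> S" "card S < 2 * card X"
proof -
  have W: "finite W" using V finite_subset by blast
  have "\<exists>X \<in> set (queries A (base_fun W)). base_fun W X \<noteq> hidden_fun W S X"
  proof (rule ccontr)
    assume "\<not> ?thesis"
    then have eq: "run A (base_fun W) = run A (hidden_fun W S)"
      by (intro run_cong) auto
    \<comment> \<open>Both runs claim the same value \<open>v\<close>. It is at least 1 as a value
      of the base function on a nonempty set, yet at most 0 because the hidden function vanishes at
      \<open>S\<close>.\<close>
    obtain X v where X: "run A (base_fun W) = (X, v)" "X \<noteq> {}" "v = base_fun W X"
      using bspec[OF A[unfolded solves_def] base_fun_instances[OF W V(3)]] by auto
    have v: "v = Min {hidden_fun W S Y |Y. Y \<subseteq> V \<and> Y \<noteq> {}}"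
      using bspec[OF A[unfolded solves_def] hidden_fun_instances[OF W V(3) S(1)]] X(1) eq by simp
    have "card S > 0"
      using S W by (meson card_gt_0_iff finite_subset)
    then have "hidden_fun W S S = 0"
      by (simp add: hidden_fun_def)
    moreover have "S \<subseteq> V" using S V(2) by simp
    ultimately have "0 \<in> {hidden_fun W S Y |Y. Y \<subseteq> V \<and> Y \<noteq> {}}"
      using S(2) by (intro CollectI exI[of _ S]) simp
    then have "v \<le> 0"
      unfolding v using V(1) by (intro Min_le) auto
    then show False
      using X base_fun_ge_1[OF W X(2)] by simp
  qed
  then show ?thesis
    using that by (auto simp: hidden_fun_def split: if_splits)
qed

text \<open>Transversals of the matching \<open>{a, g a}\<close>, \<open>a \<in> P\<close>, indexed by their intersections with \<open>P\<close>.\<close>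

definition transversal :: "('a \<Rightarrow> 'a) \<Rightarrow> 'a set \<Rightarrow> 'a set \<Rightarrow> 'a set" where
  "transversal g P T = T \<union> g ` (P - T)"

lemma card_transversal:
  assumes "finite P" "inj_on g P" "P \<inter> g ` P = {}" "T \<subseteq> P"
  shows "card (transversal g P T) = card P"
proof -
  have "card (T \<union> g ` (P - T)) = card T + card (g ` (P - T))"
    using assms finite_subset[of T P] by (intro card_Un_disjoint) auto
  also have "card (g ` (P - T)) = card (P - T)"
    using assms by (intro card_image) (auto intro: inj_on_subset)
  finally show ?thesis
    using assms card_mono[of P T] finite_subset[of T P]
    by (simp add: transversal_def card_Diff_subset)
qed

text \<open>Each element of \<open>X\<close> decides whether one element of \<open>P\<close> belongs
  to \<open>T\<close>. If some transversal contains \<open>X\<close>, these decisions concern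
  distinct elements of \<open>P\<close>, so at most \<open>card P - card X\<close> choices stay
  free.\<close>

lemma card_transversals_superset:
  assumes P: "finite P" "inj_on g P" "P \<inter> g ` P = {}"
  shows "card {T. T \<subseteq> P \<and> X \<subseteq> transversal g P T} \<le> 2 ^ (card P - card X)"
    (is "card ?F \<le> _")
proof (cases "?F = {}")
  case False
  then obtain T0 where T0: "T0 \<subseteq> P" "X \<subseteq> transversal g P T0" by blast
  define C where "C = X \<inter> P"
  define D where "D = {a \<in> P. g a \<in> X}"
  have fin: "finite C" "finite D" using P by (auto simp: C_def D_def)
  have sep: "C \<subseteq> T" "T \<inter> D = {}" if "T \<in> ?F" for T
    using that P by (auto simp: C_def D_def transversal_def inj_on_def) blast+
  have "C \<inter> D = {}" using sep[of T0] T0 by auto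
  then have "card (C \<union> D) = card C + card D"
    using fin by (intro card_Un_disjoint)
  moreover have "X = C \<union> g ` D"
    using T0 by (auto simp: C_def D_def transversal_def)
  then have "card X \<le> card C + card D"
    using card_Un_le[of C "g ` D"] card_image_le[OF fin(2), of g] by simp
  ultimately have "card (P - (C \<union> D)) \<le> card P - card X"
    using fin by (subst card_Diff_subset) (auto simp: C_def D_def)
  \<comment> \<open>Every such \<open>T\<close> contains \<open>C\<close>, hence is recovered from
    \<open>T - C\<close>.\<close>
  have "inj_on (\<lambda>T. T - C) ?F"
    using sep(1) by (intro inj_onI) blast
  moreover have "(\<lambda>T. T - C) ` ?F \<subseteq> Pow (P - (C \<union> D))"
    using sep(2) by blast
  ultimately have "card ?F \<le> card (Pow (P - (C \<union> D)))"
    using P by (intro card_inj_on_le) auto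
  also have "\<dots> = 2 ^ card (P - (C \<union> D))"
    using P by (simp add: card_Pow)
  also have "\<dots> \<le> 2 ^ (card P - card X)"
    using \<open>card (P - (C \<union> D)) \<le> _\<close> by (intro power_increasing) auto
  finally show ?thesis .
qed (metis (lifting) card.empty zero_le)

section \<open>Covering all transversals by queries\<close>

lemma oracle_calls_base_fun:
  assumes A: "solves A V d" and V: "finite V" "P \<union> g ` P \<subseteq> V"
    and d: "2 * card P < d" and P: "P \<noteq> {}" "inj_on g P" "P \<inter> g ` P = {}"
  shows "real (oracle_calls A (base_fun (P \<union> g ` P))) \<ge> 2 powr (real (card P) / 2)"
proof -
  define W where "W = P \<union> g ` P"
  define r where "r = card P"
  define Q where "Q = {X \<in> set (queries A (base_fun W)). r < 2 * card X}"
  have fin: "finite P" using V finite_subset by blast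
  have "card W \<le> 2 * card P"
    using fin card_Un_le[of P "g ` P"] card_image_le[of P g] unfolding W_def by linarith
  then have W: "card W < d" using d by simp
  \<comment> \<open>The queries made on the base function do not depend on \<open>T\<close>, so this
    single list has to hit every transversal.\<close>
  have "Pow P \<subseteq> (\<Union>X\<in>Q. {T. T \<subseteq> P \<and> X \<subseteq> transversal g P T})"
  proof
    fix T assume "T \<in> Pow P"
    then have T: "T \<subseteq> P" by simp
    have "transversal g P T \<subseteq> W" "transversal g P T \<noteq> {}"
      using T P(1) by (auto simp: transversal_def W_def)
    with solves_query_half[OF A V(1) _ W] V(2) obtain X where
      "X \<in> set (queries A (base_fun W))" "X \<subseteq> transversal g P T"
      "card (transversal g P T) < 2 * card X"
      unfolding W_def by metis
    then show "T \<in> (\<Union>X\<in>Q. {T. T \<subseteq> P \<and> X \<subseteq> transversal g P T})"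
      using T card_transversal[OF fin P(2,3) T] by (auto simp: Q_def r_def)
  qed
  moreover have finQ: "finite Q" by (simp add: Q_def)
  have "finite (\<Union>X\<in>Q. {T. T \<subseteq> P \<and> X \<subseteq> transversal g P T})"
    using fin finQ by auto
  ultimately have "card (Pow P) \<le> (\<Sum>X\<in>Q. card {T. T \<subseteq> P \<and> X \<subseteq> transversal g P T})"
    by (intro order_trans[OF card_mono card_UN_le[OF finQ]])
  then have "real (2 ^ r) \<le> (\<Sum>X\<in>Q. real (card {T. T \<subseteq> P \<and> X \<subseteq> transversal g P T}))"
    using fin by (simp add: card_Pow r_def flip: of_nat_sum of_nat_le_iff)
  also have "\<dots> \<le> (\<Sum>X\<in>Q. 2 powr (real r / 2))"
  proof (rule sum_mono)
    fix X assume X: "X \<in> Q"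
    have "real (card {T. T \<subseteq> P \<and> X \<subseteq> transversal g P T}) \<le> real (2 ^ (r - card X))"
      using card_transversals_superset[OF fin P(2,3)] unfolding r_def of_nat_le_iff .
    also have "\<dots> = 2 powr real (r - card X)"
      by (simp add: powr_realpow)
    \<comment> \<open>Membership in \<open>Q\<close> gives \<open>r < 2 * card X\<close>. If
      \<open>card X\<close> exceeds \<open>r\<close>, the natural subtraction yields 0, which also
      satisfies the bound.\<close>
    also have "\<dots> \<le> 2 powr (real r / 2)"
      using X by (intro powr_mono) (auto simp: Q_def)
    finally show "real (card {T. T \<subseteq> P \<and> X \<subseteq> transversal g P T}) \<le> 2 powr (real r / 2)" .
  qed
  also have "\<dots> = real (card Q) * 2 powr (real r / 2)" by simp
  finally have "2 powr (real r / 2) * 2 powr (real r / 2) \<le> real (card Q) * 2 powr (real r / 2)"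
    by (simp flip: powr_add powr_realpow)
  then have "2 powr (real r / 2) \<le> real (card Q)" by simp
  also have "card Q \<le> card (set (queries A (base_fun W)))"
    by (intro card_mono) (auto simp: Q_def)
  also have "\<dots> \<le> oracle_calls A (base_fun W)"
    by (simp add: oracle_calls_def card_length)
  finally show ?thesis by (simp add: r_def W_def)
qed

section \<open>Choice of the matching and of the constants\<close>

lemma obtain_matching:
  assumes "finite V" "2 * r \<le> card V"
  obtains P g where "P \<union> g ` P \<subseteq> V" "card P = r" "inj_on g P" "P \<inter> g ` P = {}"
proof -
  obtain P where P: "P \<subseteq> V" "card P = r"
    using assms obtain_subset_with_card_n[of r V] by auto
  have finP: "finite P" using P assms finite_subset by blast
  have "r \<le> card (V - P)"
    using assms P finP by (simp add: card_Diff_subset)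
  then obtain Q where Q: "Q \<subseteq> V - P" "card Q = r"
    using obtain_subset_with_card_n by metis
  have "finite Q" using Q assms by (meson finite_Diff finite_subset)
  then obtain g where "bij_betw g P Q"
    using finP P Q finite_same_card_bij by metis
  then show thesis
    using that[of P g] P Q by (auto simp: bij_betw_def)
qed

theorem theorem2:
  "\<exists>c::real. c > 0 \<and> (\<forall>\<^sub>F d in at_top. \<forall>V :: 'a set.
     finite V \<longrightarrow> d \<le> 2 * card V \<longrightarrow>
       (\<forall>A. solves A V d \<longrightarrow>
          (\<exists>f \<in> instances V d. real (oracle_calls A f) \<ge> c * 2 powr (real d / 15.08))))"
proof (intro exI[of _ "1/2"] conjI eventually_mono[OF eventually_ge_at_top[of 4]] allI impI)
  fix d :: nat and V :: "'a set" and A :: "'a algorithm"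
  assume d: "4 \<le> d" and V: "finite V" "d \<le> 2 * card V" and A: "solves A V d"
  \<comment> \<open>A quarter of \<open>d\<close> suits both constraints: \<open>2 * r\<close> stays
    below \<open>d\<close>, and it is at most half of \<open>d\<close>, hence at most
    \<open>card V\<close>. From \<open>4 \<le> d\<close> the matching is nonempty.\<close>
  define r where "r = d div 4"
  have r: "r > 0" "2 * r < d" "2 * r \<le> card V" "4 * r + 3 \<ge> d"
    using d V by (auto simp: r_def)
  obtain P g where P: "P \<union> g ` P \<subseteq> V" "card P = r" "inj_on g P" "P \<inter> g ` P = {}"
    using obtain_matching[OF V(1) r(3)] .
  have fin: "finite P" "P \<noteq> {}" using P r(1) V(1) finite_subset by auto
  let ?f = "base_fun (P \<union> g ` P)"
  have "(1/2) * 2 powr (real d / 15.08) = 2 powr (real d / 15.08 - 1)"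
    by (simp add: powr_diff)
  also have "\<dots> \<le> 2 powr (real r / 2)"
  proof (rule powr_mono)
    \<comment> \<open>Rounding costs at most 3/15.08 < 1 in the exponent, which the factor 1/2
      absorbs; the rest follows from 4/15.08 < 1/2.\<close>
    have "real d \<le> 4 * real r + 3" using r(4) by linarith
    then show "real d / 15.08 - 1 \<le> real r / 2" by (simp add: field_simps)
  qed simp
  also have "\<dots> \<le> real (oracle_calls A ?f)"
    using oracle_calls_base_fun[OF A V(1) P(1) _ fin(2) P(3,4)] P(2) r(2) by simp
  finally have "real (oracle_calls A ?f) \<ge> (1/2) * 2 powr (real d / 15.08)" .
  moreover have "card (P \<union> g ` P) < d"
    using r(2) P(2) fin card_Un_le[of P "g ` P"] card_image_le[of P g] by linarith
  then have "?f \<in> instances V d"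
    using fin by (intro base_fun_instances) auto
  ultimately show "\<exists>f \<in> instances V d. real (oracle_calls A f) \<ge> (1/2) * 2 powr (real d / 15.08)"
    by blast
qed simp

end
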